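(* Let $(X,d)$ be a metric space, $T:X\to X$ a self-mapping, $\zeta$ a simulation function, $x_0\in X$ and $\alpha:X\times X\to(0,\infty)$ a function. Let $\rho=\inf_{x\in X}\{d(x,Tx)\mid Tx\neq x\}$. Let $T$ be an $\alpha$-$\mathcal{Z}_c$-contraction with respect to $\zeta$ with $x_0$, and assume that $T$ is $\alpha$-$x_0$-admissible. If $\alpha(x_0,x)\geq 1$ for all $x\in D_{x_0,\rho}$ and $0<d(Tx,x_0)\leq\rho$ for all $x\in D_{x_0,\rho}\setminus\{x_0\}$, then $D_{x_0,\rho}$ is a fixed disc of $T$.
   Context: A function $\zeta:[0,\infty)^2\to\mathbb{R}$ is a simulation function if: $(\zeta_1)$ $\zeta(0,0)=0$; $(\zeta_2)$ $\zeta(t,s)<s-t$ for all $s,t>0$; $(\zeta_3)$ if $\{t_n\},\{s_n\}$ are sequences in $(0,\infty)$ with $\lim_{n\to\infty}t_n=\lim_{n\to\infty}s_n>0$, then $\limsup_{n\to\infty}\zeta(t_n,s_n)<0$. $T$ is an $\alpha$-$\mathcal{Z}_c$-contraction with respect to $\zeta$ with $x_0$ if for all $x\in X$: $d(Tx,x)>0\Rightarrow\zeta\left(\alpha(x_0,Tx)\,d(x,Tx),\,d(Tx,x_0)\right)\geq 0$. $T$ is $\alpha$-$x_0$-admissible if for every $x\in X$: $\alpha(x_0,x)\geq 1\Rightarrow\alpha(x_0,Tx)\geq 1$. For $r\in[0,\infty)$, $D_{x_0,r}=\{x\in X: d(x,x_0)\leq r\}$. The disc $D_{x_0,r}$ is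 called a fixed disc of $T$ if $Tx=x$ for all $x\in D_{x_0,r}$. The number $\rho$ is taken to be an element of $[0,\infty)$. *)

theory Defs
  imports "HOL-Analysis.Analysis"
begin

(* A function on [0,oo)^2 is represented by a total curried function on the reals;
   only its values at nonnegative arguments are constrained or used below.
   The limsup is taken in the extended reals, as the sequence may be unbounded below. *)
definition simulation_function :: "(real \<Rightarrow> real \<Rightarrow> real) \<Rightarrow> bool" where
  "simulation_function \<zeta> \<longleftrightarrow>
     \<zeta> 0 0 = 0 \<and>
     (\<forall>t>0. \<forall>s>0. \<zeta> t s < s - t) \<and>
     (\<forall>(t :: nat \<Rightarrow> real) (s :: nat \<Rightarrow> real) l.
        (\<forall>n. t n > 0) \<longrightarrow> (\<forall>n. s n > 0) \<longrightarrow> t \<longlonglongrightarrow> l \<longrightarrow> s \<longlonglongrightarrow> l \<longrightarrow> l > 0 \<longrightarrow>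
        limsup (\<lambda>n. ereal (\<zeta> (t n) (s n))) < 0)"

definition alpha_Zc_contraction ::
  "('a::metric_space \<Rightarrow> 'a \<Rightarrow> real) \<Rightarrow> (real \<Rightarrow> real \<Rightarrow> real) \<Rightarrow> 'a \<Rightarrow> ('a \<Rightarrow> 'a) \<Rightarrow> bool" where
  "alpha_Zc_contraction \<alpha> \<zeta> x0 T \<longleftrightarrow>
     (\<forall>x. dist (T x) x > 0 \<longrightarrow> \<zeta> (\<alpha> x0 (T x) * dist x (T x)) (dist (T x) x0) \<ge> 0)"

definition alpha_admissible :: "('a \<Rightarrow> 'a \<Rightarrow> real) \<Rightarrow> 'a \<Rightarrow> ('a \<Rightarrow> 'a) \<Rightarrow> bool" where
  "alpha_admissible \<alpha> x0 T \<longleftrightarrow> (\<forall>x. \<alpha> x0 x \<ge> 1 \<longrightarrow> \<alpha> x0 (T x) \<ge> 1)"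

definition fixed_disc :: "('a::metric_space \<Rightarrow> 'a) \<Rightarrow> 'a \<Rightarrow> real \<Rightarrow> bool" where
  "fixed_disc T x0 r \<longleftrightarrow> (\<forall>x\<in>cball x0 r. T x = x)"

end

theory Submission
  imports Defs
begin

text \<open>Suppose T moves a point x of the disc. Since \<rho> is the least displacement in the
  infimum sense, d(Tx,x0) is positive and at most d(x,Tx). Admissibility makes the weight
  \<alpha>(x0,Tx) at least 1, so the arguments t, s of \<zeta> in the contraction condition satisfy
  t \<ge> s > 0. Then \<zeta>(t,s) < s - t \<le> 0, against \<zeta>(t,s) \<ge> 0.\<close>

theorem theorem2p13:
  fixes T :: "'a::metric_space \<Rightarrow> 'a"
    and \<zeta> :: "real \<Rightarrow> real \<Rightarrow> real"
    and x0 :: 'a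
    and \<alpha> :: "'a \<Rightarrow> 'a \<Rightarrow> real"
    and \<rho> :: real
  assumes "simulation_function \<zeta>"
    and "\<And>x y. \<alpha> x y > 0"
    and "\<rho> = Inf {dist x (T x) | x. T x \<noteq> x}"
    and "\<rho> \<ge> 0"
    and "alpha_Zc_contraction \<alpha> \<zeta> x0 T"
    and "alpha_admissible \<alpha> x0 T"
    and "\<And>x. x \<in> cball x0 \<rho> \<Longrightarrow> \<alpha> x0 x \<ge> 1"
    and "\<And>x. x \<in> cball x0 \<rho> - {x0} \<Longrightarrow> 0 < dist (T x) x0 \<and> dist (T x) x0 \<le> \<rho>"
  shows "fixed_disc T x0 \<rho>"
  unfolding fixed_disc_def
proof (rule ballI, rule ccontr)
  fix x
  assume x: "x \<in> cball x0 \<rho>" and moved: "T x \<noteq> x"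
  have "bdd_below {dist x (T x) | x. T x \<noteq> x}"
    by (rule bdd_belowI[of _ 0]) auto
  then have "\<rho> \<le> dist x (T x)"
    unfolding assms(3) using moved by (intro cInf_lower) auto
  \<comment> \<open>At the centre the two distances coincide and are positive because x is moved;
    elsewhere d(Tx,x0) \<le> \<rho> \<le> d(x,Tx).\<close>
  then have s: "0 < dist (T x) x0" "dist (T x) x0 \<le> dist x (T x)"
    using assms(8)[of x] x moved by (cases "x = x0"; force simp: dist_commute)+
  have "\<alpha> x0 (T x) \<ge> 1"
    using assms(6,7) x unfolding alpha_admissible_def by blast
  then have t: "dist x (T x) \<le> \<alpha> x0 (T x) * dist x (T x)"
    by (simp add: mult_le_cancel_right1)
  \<comment> \<open>The strict bound on \<zeta> is available only when both arguments are
    positive.\<close>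
  then have "0 < \<alpha> x0 (T x) * dist x (T x)"
    using s by linarith
  then have "\<zeta> (\<alpha> x0 (T x) * dist x (T x)) (dist (T x) x0)
      < dist (T x) x0 - \<alpha> x0 (T x) * dist x (T x)"
    using assms(1) s unfolding simulation_function_def by blast
  moreover have "0 \<le> \<zeta> (\<alpha> x0 (T x) * dist x (T x)) (dist (T x) x0)"
    using assms(5) moved unfolding alpha_Zc_contraction_def by simp
  ultimately show False
    using s t by linarith
qed

end
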